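(* In three-dimensional projective space, let $O$ be a point not on either of two distinct planes $\overline{\pi}$ and $\pi$. Let $\overline{P}\,\overline{Q}\,\overline{R}\,\overline{S}$ be a quadrangle in $\overline{\pi}$ and let $PQRS$ be a quadrangle in $\pi$. Let $\overline{A}\,\overline{B}\,\overline{C}$ and $ABC$ be their respective diagonal triangles. If the quadrangles $\overline{P}\,\overline{Q}\,\overline{R}\,\overline{S}$ and $PQRS$ are perspective from $O$, then the diagonal triangles $\overline{A}\,\overline{B}\,\overline{C}$ and $ABC$ are perspective from $O$.
   Context: The setting is a three-dimensional projective space in the classical synthetic sense of Veblen and Young (incidence axioms for points, lines and planes; every line contains at least three points); in particular any two lines in the same plane have a point of intersection. A quadrangle $PQRS$ in a plane consists of four points (vertices) $P,Q,R,S$ of that plane, no three of which are collinear. For lines $\ell, m$, $\ell\cdot m$ denotes their intersection. The diagonal triangle of the quadrangle $PQRS$ is the triple $ABC$ of points in which its opposite sides intersect: $$A = SP\cdot QR,\quad B = SQ\cdot RP,\quad C = SR\cdot PQ.$$ The diagonal points of a quadrangle with decorated vertices carry the same decoration (so $\overline{A} = \overline{S}\,\overline{P}\cdot\overline{Q}\,\overline{R}$, and so on). Two ordered figures $X_1Y_1Z_1\cdots$ and $X_2Y_2Z_2\cdots$ (triples or quadruples of points) are perspective from a point $O$ when the lines $X_1X_2$, $Y_1Y_2$, $Z_1Z_2,\ldots$ joining corresponding points all pass through $O$. Corresponding points are allowed to coincide, so the condition is that $O$ and each corresponding pair are collinear. *)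

theory Defs
  imports Main
begin

text \<open>
  Following Veblen and Young, the points are the elements of the type \<open>'p\<close>, and a line is a set of
  points; \<open>L\<close> is the set of all lines. Planes and three-spaces are not primitive: each is obtained
  by joining a point to all points of a line (respectively a plane) not containing it.
\<close>

definition collinear :: "'p set set \<Rightarrow> 'p \<Rightarrow> 'p \<Rightarrow> 'p \<Rightarrow> bool" where
  "collinear L X Y Z \<longleftrightarrow> (\<exists>l\<in>L. X \<in> l \<and> Y \<in> l \<and> Z \<in> l)"

definition plane :: "'p set set \<Rightarrow> 'p set \<Rightarrow> bool" where
  "plane L \<pi> \<longleftrightarrow> (\<exists>P. \<exists>l\<in>L. P \<notin> l \<and> \<pi> = {X. \<exists>Y\<in>l. collinear L P X Y})"

definition three_space :: "'p set set \<Rightarrow> 'p set \<Rightarrow> bool" where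
  "three_space L \<Sigma> \<longleftrightarrow> (\<exists>P \<pi>. plane L \<pi> \<and> P \<notin> \<pi> \<and> \<Sigma> = {X. \<exists>Y\<in>\<pi>. collinear L P X Y})"

text \<open>
  The assumptions of alignment and extension of Veblen and Young. That two lines of a plane
  meet is a consequence of the third one; the last one bounds the dimension by three.
\<close>

locale projective_3_space =
  fixes L :: "'p set set"
  assumes line_exists: "X \<noteq> Y \<Longrightarrow> \<exists>l\<in>L. X \<in> l \<and> Y \<in> l"
    and line_unique:
      "\<lbrakk>X \<noteq> Y; l \<in> L; m \<in> L; X \<in> l; Y \<in> l; X \<in> m; Y \<in> m\<rbrakk> \<Longrightarrow> l = m"
    and triangle_transversal:
      "\<lbrakk>\<not> collinear L X Y Z; U \<noteq> V; collinear L Y Z U; collinear L Z X V\<rbrakk>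
        \<Longrightarrow> \<exists>W. collinear L X Y W \<and> collinear L U V W"
    and three_points:
      "l \<in> L \<Longrightarrow> \<exists>X\<in>l. \<exists>Y\<in>l. \<exists>Z\<in>l. X \<noteq> Y \<and> X \<noteq> Z \<and> Y \<noteq> Z"
    and some_line: "L \<noteq> {}"
    and not_all_on_line: "l \<in> L \<Longrightarrow> \<exists>X. X \<notin> l"
    and not_all_on_plane: "plane L \<pi> \<Longrightarrow> \<exists>X. X \<notin> \<pi>"
    and all_on_three_space: "three_space L \<Sigma> \<Longrightarrow> X \<in> \<Sigma>"

text \<open>
  The next two are meaningful only for distinct points, respectively for distinct intersecting
  lines; the sides of a quadrangle and the pairs of its opposite sides satisfy this.
\<close>

definition join :: "'p set set \<Rightarrow> 'p \<Rightarrow> 'p \<Rightarrow> 'p set" where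
  "join L X Y = (THE l. l \<in> L \<and> X \<in> l \<and> Y \<in> l)"

definition meet :: "'p set \<Rightarrow> 'p set \<Rightarrow> 'p" where
  "meet l m = (THE X. X \<in> l \<and> X \<in> m)"

definition quadrangle :: "'p set set \<Rightarrow> 'p set \<Rightarrow> 'p \<Rightarrow> 'p \<Rightarrow> 'p \<Rightarrow> 'p \<Rightarrow> bool" where
  "quadrangle L \<pi> P Q R S \<longleftrightarrow>
    P \<in> \<pi> \<and> Q \<in> \<pi> \<and> R \<in> \<pi> \<and> S \<in> \<pi> \<and> distinct [P, Q, R, S] \<and>
    \<not> collinear L P Q R \<and> \<not> collinear L P Q S \<and> \<not> collinear L P R S \<and> \<not> collinear L Q R S"

definition diagonal_triangle :: "'p set set \<Rightarrow> 'p \<Rightarrow> 'p \<Rightarrow> 'p \<Rightarrow> 'p \<Rightarrow> 'p \<times> 'p \<times> 'p" where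
  "diagonal_triangle L P Q R S =
    (meet (join L S P) (join L Q R),
     meet (join L S Q) (join L R P),
     meet (join L S R) (join L P Q))"

text \<open>
  Ordered figures are lists of points. Corresponding points may coincide, hence
  collinearity with the centre rather than incidence of the centre with a joining line.
\<close>

definition perspective :: "'p set set \<Rightarrow> 'p \<Rightarrow> 'p list \<Rightarrow> 'p list \<Rightarrow> bool" where
  "perspective L Z Xs Ys \<longleftrightarrow> list_all2 (\<lambda>X Y. collinear L Z X Y) Xs Ys"

end

theory Submission
  imports Defs
begin

text \<open>
  The line through \<open>Z\<close> and a point of a side \<open>S'P'\<close> meets the corresponding side \<open>SP\<close>, since the
  two sides lie in a plane through \<open>Z\<close>. Hence the line \<open>ZA'\<close> meets both \<open>SP\<close> and \<open>QR\<close>; since \<open>Z\<close> is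
  not in \<open>\<pi>\<close>, this line has only one point in \<open>\<pi>\<close>, so it passes through \<open>SP \<cdot> QR = A\<close>. What has to be
  derived from the axioms is that a plane contains the line joining any two of its points, and that
  any two of its lines meet.
\<close>

context projective_3_space
begin

section \<open>Joins, intersections and the triangle axiom\<close>

lemma join_line:
  assumes "X \<noteq> Y"
  shows "join L X Y \<in> L" "X \<in> join L X Y" "Y \<in> join L X Y"
proof -
  have "\<exists>!l. l \<in> L \<and> X \<in> l \<and> Y \<in> l"
    using line_exists[OF assms] line_unique[OF assms] by blast
  from theI'[OF this]
  show "join L X Y \<in> L" "X \<in> join L X Y" "Y \<in> join L X Y"
    unfolding join_def by auto
qed

lemma meet_eq:
  assumes "l \<in> L" "m \<in> L" "l \<noteq> m" "X \<in> l" "X \<in> m"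
  shows "meet l m = X"
  unfolding meet_def using assms line_unique by (intro the_equality) blast+

lemma collinear_mem:
  assumes "collinear L X Y W" "X \<noteq> Y" "l \<in> L" "X \<in> l" "Y \<in> l"
  shows "W \<in> l"
  using assms line_unique unfolding collinear_def by blast

text \<open>This puts \<open>triangle_transversal\<close> into incidence form, for the triangle
  \<open>Y\<close>, \<open>T\<close>, \<open>X\<close> with sides \<open>a\<close>,
  \<open>b\<close>, \<open>c\<close>. Later existence proofs then reduce to choosing a triangle and
  a transversal.\<close>

lemma transversal_meets_third_side:
  assumes "a \<in> L" "b \<in> L" "c \<in> L" "n \<in> L"
    and "Y \<in> a" "T \<in> a" "T \<in> b" "X \<in> b" "X \<in> c" "Y \<in> c"
    and "Y \<noteq> T" "X \<notin> a"
    and "U \<in> a" "U \<in> n" "V \<in> b" "V \<in> n" "U \<noteq> V"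
  obtains W where "W \<in> c" "W \<in> n"
proof -
  have "\<not> collinear L X Y T"
    using assms line_unique unfolding collinear_def by blast
  moreover have "collinear L Y T U" "collinear L T X V"
    using assms unfolding collinear_def by blast+
  ultimately obtain W where "collinear L X Y W" "collinear L U V W"
    using triangle_transversal \<open>U \<noteq> V\<close> by blast
  moreover have "X \<noteq> Y"
    using assms by blast
  ultimately show thesis
    using that collinear_mem assms by blast
qed

section \<open>Planes spanned by a vertex and a base line\<close>

lemma line_through_vertex_meets_base:
  assumes "E \<notin> l" "l \<in> L" "\<pi> = {X. \<exists>Y\<in>l. collinear L E X Y}"
    and "X \<in> \<pi>" "X \<noteq> E" "m \<in> L" "E \<in> m" "X \<in> m"
  obtains Y where "Y \<in> l" "Y \<in> m"
  using assms collinear_mem by blast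

text \<open>Projecting \<open>X\<^sub>1\<close> and \<open>X\<^sub>2\<close> from \<open>E\<close>
  to \<open>l\<close> gives a triangle with vertex \<open>E\<close> and third side on
  \<open>l\<close>; \<open>m\<close> crosses the two projecting lines.\<close>

lemma plane_line_meets_base:
  assumes E: "E \<notin> l" "l \<in> L" "\<pi> = {X. \<exists>Y\<in>l. collinear L E X Y}"
    and X: "X\<^sub>1 \<in> \<pi>" "X\<^sub>2 \<in> \<pi>" "X\<^sub>1 \<noteq> X\<^sub>2" "m \<in> L" "X\<^sub>1 \<in> m" "X\<^sub>2 \<in> m"
  obtains W where "W \<in> l" "W \<in> m"
proof (cases "E \<in> m")
  case True
  \<comment> \<open>At least one of the distinct points \<open>X\<^sub>1\<close>,
    \<open>X\<^sub>2\<close> differs from \<open>E\<close>.\<close>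
  then show ?thesis
    using line_through_vertex_meets_base[OF E] X that by metis
next
  case False
  obtain Y\<^sub>1 a where 1: "Y\<^sub>1 \<in> l" "a \<in> L" "E \<in> a" "X\<^sub>1 \<in> a" "Y\<^sub>1 \<in> a"
    using E X unfolding collinear_def by blast
  obtain Y\<^sub>2 b where 2: "Y\<^sub>2 \<in> l" "b \<in> L" "E \<in> b" "X\<^sub>2 \<in> b" "Y\<^sub>2 \<in> b"
    using E X unfolding collinear_def by blast
  have "a \<noteq> b"
    using False 1 2 X line_unique by blast
  then have "Y\<^sub>2 \<notin> a"
    using 1 2 E line_unique[of E Y\<^sub>2 a b] by blast
  then show ?thesis
    using transversal_meets_third_side[of a b l m Y\<^sub>1 E Y\<^sub>2 X\<^sub>1 X\<^sub>2] 1 2 E X that by blast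
qed

text \<open>In the general case the line \<open>n\<close> joining \<open>E\<close> to
  \<open>X\<close> crosses two sides of a triangle \<open>W\<close>, \<open>X'\<close>,
  \<open>Y\<close>: the side on \<open>m\<close> at \<open>X\<close>, and the projecting line of
  \<open>X'\<close> at \<open>E\<close>. It therefore meets the third side, which lies on
  \<open>l\<close>.\<close>

lemma line_subset_plane:
  assumes "plane L \<pi>" "X\<^sub>1 \<in> \<pi>" "X\<^sub>2 \<in> \<pi>" "X\<^sub>1 \<noteq> X\<^sub>2" "m \<in> L" "X\<^sub>1 \<in> m" "X\<^sub>2 \<in> m"
  shows "m \<subseteq> \<pi>"
proof
  fix X assume "X \<in> m"
  obtain E l where E: "E \<notin> l" "l \<in> L" "\<pi> = {X. \<exists>Y\<in>l. collinear L E X Y}"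
    using \<open>plane L \<pi>\<close> unfolding plane_def by blast
  obtain W where W: "W \<in> l" "W \<in> m"
    using plane_line_meets_base[OF E] assms by metis
  have "\<exists>n\<in>L. E \<in> n \<and> X \<in> n \<and> (\<exists>Y\<in>l. Y \<in> n)"
  proof -
    consider "E \<in> m" | "m = l" | "E \<notin> m" "m \<noteq> l"
      by blast
    then show ?thesis
    proof cases
      case 1
      then show ?thesis
        using W \<open>X \<in> m\<close> assms by blast
    next
      case 2
      then show ?thesis
        using \<open>X \<in> m\<close> E line_exists by metis
    next
      case 3
      \<comment> \<open>Since \<open>m\<close> and \<open>l\<close> are distinct, one of
        \<open>X\<^sub>1\<close>, \<open>X\<^sub>2\<close> is off \<open>l\<close> and serves as
        \<open>X'\<close>.\<close>
      obtain X' where X': "X' \<in> \<pi>" "X' \<in> m" "X' \<notin> l"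
        using assms E 3 line_unique[of X\<^sub>1 X\<^sub>2 m l] by blast
      obtain Y a where Y: "Y \<in> l" "a \<in> L" "E \<in> a" "X' \<in> a" "Y \<in> a"
        using E X' unfolding collinear_def by blast
      obtain n where n: "n \<in> L" "E \<in> n" "X \<in> n"
        using 3 \<open>X \<in> m\<close> line_exists by metis
      have "W \<notin> a"
        using W Y X' 3 \<open>m \<in> L\<close> line_unique by metis
      then obtain V where "V \<in> l" "V \<in> n"
        using transversal_meets_third_side[of a m l n Y X' W E X]
          W Y X' n 3 E \<open>X \<in> m\<close> \<open>m \<in> L\<close> by metis
      then show ?thesis
        using n by blast
    qed
  qed
  then show "X \<in> \<pi>"
    using E unfolding collinear_def by blast
qed

text \<open>A point \<open>M\<close> of \<open>n\<close> off the base projects from \<open>E\<close>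
  to \<open>Y\<close>. Unless \<open>M\<close> already lies on \<open>m\<close>, the line
  \<open>n\<close> crosses the sides \<open>l\<close> and \<open>a\<close> of the triangle
  \<open>E\<close>, \<open>W\<^sub>1\<close>, \<open>Y\<close>, hence also \<open>m\<close>.\<close>

lemma line_through_vertex_meets_line:
  assumes E: "E \<notin> l" "l \<in> L" "\<pi> = {X. \<exists>Y\<in>l. collinear L E X Y}"
    and m: "m \<in> L" "E \<in> m" "W\<^sub>1 \<in> l" "W\<^sub>1 \<in> m"
    and n: "n \<in> L" "n \<subseteq> \<pi>" "E \<notin> n"
  obtains W where "W \<in> m" "W \<in> n"
proof (cases "n = l")
  case True
  then show ?thesis
    using m that by blast
next
  case False
  obtain N N' where N: "N \<in> n" "N' \<in> n" "N \<noteq> N'"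
    using three_points n by metis
  obtain W\<^sub>2 where W2: "W\<^sub>2 \<in> l" "W\<^sub>2 \<in> n"
    using plane_line_meets_base[OF E, of N N' n] N n by blast
  obtain M where M: "M \<in> n" "M \<noteq> W\<^sub>2"
    using N by blast
  obtain Y a where Y: "Y \<in> l" "a \<in> L" "E \<in> a" "M \<in> a" "Y \<in> a"
    using E M n unfolding collinear_def by blast
  show ?thesis
  proof (cases "Y = W\<^sub>1")
    case True
    then have "a = m"
      using Y m E True line_unique[of E Y a m] by blast
    then show ?thesis
      using M Y that by blast
  next
    case False
    then show ?thesis
      using transversal_meets_third_side[of l a m n W\<^sub>1 Y E W\<^sub>2 M]
        E Y m M W2 n that by metis
  qed
qed

text \<open>When neither line contains \<open>E\<close>, a point \<open>M\<close> of
  \<open>m\<close> is projected from \<open>E\<close> to \<open>Y\<close> on \<open>l\<close>. By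
  the preceding lemma \<open>n\<close> meets this projecting line, and it also meets
  \<open>l\<close>, so it crosses two sides of the triangle \<open>W\<^sub>1\<close>,
  \<open>Y\<close>, \<open>M\<close> whose third side is \<open>m\<close>.\<close>

lemma plane_lines_meet:
  assumes "plane L \<pi>" "m \<in> L" "n \<in> L" "m \<subseteq> \<pi>" "n \<subseteq> \<pi>"
  obtains W where "W \<in> m" "W \<in> n"
proof -
  obtain E l where E: "E \<notin> l" "l \<in> L" "\<pi> = {X. \<exists>Y\<in>l. collinear L E X Y}"
    using \<open>plane L \<pi>\<close> unfolding plane_def by blast
  have base: "\<exists>W\<in>l. W \<in> k" if k: "k \<in> L" "k \<subseteq> \<pi>" for k
  proof -
    obtain K K' where "K \<in> k" "K' \<in> k" "K \<noteq> K'"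
      using three_points k by metis
    then show ?thesis
      using plane_line_meets_base[OF E, of K K' k] k by blast
  qed
  obtain W\<^sub>1 where W1: "W\<^sub>1 \<in> l" "W\<^sub>1 \<in> m"
    using base assms by blast
  obtain W\<^sub>2 where W2: "W\<^sub>2 \<in> l" "W\<^sub>2 \<in> n"
    using base assms by blast
  consider "E \<in> m" "E \<in> n" | "E \<in> m" "E \<notin> n" | "E \<notin> m" "E \<in> n" | "m = l"
    | "E \<notin> m" "E \<notin> n" "m \<noteq> l"
    by blast
  then show thesis
  proof cases
    case 1
    then show ?thesis
      using that by blast
  next
    case 2
    then show ?thesis
      using line_through_vertex_meets_line[OF E, of m W\<^sub>1 n] W1 assms that by blast
  next
    case 3
    then show ?thesis
      using line_through_vertex_meets_line[OF E, of n W\<^sub>2 m] W2 assms that by blast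
  next
    case 4
    then show ?thesis
      using W2 that by blast
  next
    case 5
    \<comment> \<open>A third point of \<open>m\<close> is needed to choose \<open>M\<close> off the line joining \<open>E\<close> and \<open>W\<^sub>2\<close>.\<close>
    obtain k where k: "k \<in> L" "E \<in> k" "W\<^sub>2 \<in> k"
      using line_exists E W2 by metis
    obtain M where M: "M \<in> m" "M \<noteq> W\<^sub>1" "M \<notin> k"
      using three_points[OF \<open>m \<in> L\<close>] line_unique k 5 assms by metis
    obtain Y a where Y: "Y \<in> l" "a \<in> L" "E \<in> a" "M \<in> a" "Y \<in> a"
      using E M assms unfolding collinear_def by blast
    obtain K where K: "K \<in> a" "K \<in> n"
      using line_through_vertex_meets_line[OF E, of a Y n] Y assms 5 by blast
    have "K \<noteq> W\<^sub>2"
      using K Y M k E W2 line_unique[of E W\<^sub>2 a k] by blast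
    moreover have "Y \<noteq> W\<^sub>1"
      using Y M 5 W1 assms line_unique by metis
    moreover have "M \<notin> l"
      using M W1 5 E assms line_unique[of M W\<^sub>1 m l] by blast
    ultimately show ?thesis
      using transversal_meets_third_side[of l a m n W\<^sub>1 Y M W\<^sub>2 K]
        E Y K W1 W2 M assms that by metis
  qed
qed

section \<open>Perspectivity from \<open>Z\<close>\<close>

text \<open>The side \<open>h\<close> is moved to \<open>g\<close> one endpoint at a time, through
  the line \<open>f\<close> joining \<open>S\<close> and \<open>P'\<close>. First \<open>f\<close>
  crosses two sides of the triangle \<open>Z\<close>, \<open>D\<close>, \<open>S'\<close> and so
  meets \<open>k\<close> in \<open>W\<close>; then \<open>g\<close> crosses two sides of the
  triangle \<open>Z\<close>, \<open>W\<close>, \<open>P'\<close> and so meets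
  \<open>k\<close>.\<close>

lemma perspective_line_meets_side:
  assumes "h \<in> L" "P' \<in> h" "S' \<in> h" "P' \<noteq> S'" "Z \<notin> h"
    and "g \<in> L" "P \<in> g" "S \<in> g" "P \<noteq> S" "Z \<notin> g"
    and "collinear L Z P' P" "collinear L Z S' S"
    and "D \<in> h" "k \<in> L" "Z \<in> k" "D \<in> k"
  obtains X where "X \<in> g" "X \<in> k"
proof -
  obtain p s where p: "p \<in> L" "Z \<in> p" "P' \<in> p" "P \<in> p"
    and s: "s \<in> L" "Z \<in> s" "S' \<in> s" "S \<in> s"
    using assms unfolding collinear_def by blast
  \<comment> \<open>A common line would contain \<open>P'\<close> and \<open>S'\<close>, hence be
    \<open>h\<close>, which misses \<open>Z\<close>.\<close>
  have ps: "p \<noteq> s"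
    using assms p s line_unique by metis
  show thesis
  proof (cases "D = S' \<or> D = P'")
    \<comment> \<open>The first triangle degenerates here, but \<open>k\<close> is then a projecting
      line and already contains \<open>S\<close> or \<open>P\<close>.\<close>
    case True
    then have "k = s \<or> k = p"
      using assms p s line_unique by metis
    then show ?thesis
      using p s assms that by blast
  next
    case False
    have "S \<noteq> P'"
      using ps p s assms line_unique by metis
    then obtain f where f: "f \<in> L" "S \<in> f" "P' \<in> f"
      using line_exists by metis
    obtain W where W: "W \<in> k" "W \<in> f"
      using transversal_meets_third_side[of h s k f D S' Z P' S]
        assms s f False \<open>S \<noteq> P'\<close> by metis
    have "S \<notin> p"
      using ps p s assms line_unique by metis
    then have "Z \<notin> f"
      using f p assms line_unique by metis
    moreover have "W \<noteq> P'"
      using W False p assms line_unique by metis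
    ultimately show ?thesis
      using transversal_meets_third_side[of f p k g W P' Z S P]
        W f p assms that by metis
  qed
qed

text \<open>Stated for one pair of opposite sides, so that relabelling vertices yields all three
  diagonal points. The non-collinear triples keep opposite sides distinct, as \<open>meet_eq\<close>
  requires.\<close>

lemma perspective_diagonal_point:
  assumes \<pi>: "plane L \<pi>" "Z \<notin> \<pi>" "P \<in> \<pi>" "Q \<in> \<pi>" "R \<in> \<pi>" "S \<in> \<pi>"
      "S \<noteq> P" "Q \<noteq> R" "\<not> collinear L S P Q"
    and \<pi>': "plane L \<pi>'" "Z \<notin> \<pi>'" "P' \<in> \<pi>'" "Q' \<in> \<pi>'" "R' \<in> \<pi>'" "S' \<in> \<pi>'"
      "S' \<noteq> P'" "Q' \<noteq> R'" "\<not> collinear L S' P' Q'"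
    and persp: "collinear L Z P' P" "collinear L Z Q' Q" "collinear L Z R' R" "collinear L Z S' S"
  shows "collinear L Z (meet (join L S' P') (join L Q' R')) (meet (join L S P) (join L Q R))"
proof -
  let ?g = "join L S P" and ?h = "join L Q R" and ?g' = "join L S' P'" and ?h' = "join L Q' R'"
  note g = join_line[OF \<open>S \<noteq> P\<close>] and h = join_line[OF \<open>Q \<noteq> R\<close>]
    and g' = join_line[OF \<open>S' \<noteq> P'\<close>] and h' = join_line[OF \<open>Q' \<noteq> R'\<close>]
  have sub: "?g \<subseteq> \<pi>" "?h \<subseteq> \<pi>" "?g' \<subseteq> \<pi>'" "?h' \<subseteq> \<pi>'"
    using line_subset_plane \<pi> \<pi>' g h g' h' by metis+
  have "?g \<noteq> ?h" "?g' \<noteq> ?h'"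
    using \<pi> \<pi>' g h g' h' unfolding collinear_def by metis+
  obtain D where D: "D \<in> ?g'" "D \<in> ?h'"
    using plane_lines_meet[of \<pi>' ?g' ?h'] \<pi>' g' h' sub by blast
  then have meet': "meet ?g' ?h' = D"
    using meet_eq g' h' \<open>?g' \<noteq> ?h'\<close> by blast
  obtain k where k: "k \<in> L" "Z \<in> k" "D \<in> k"
    using line_exists[of Z D] D sub \<pi>' by blast
  obtain X where X: "X \<in> ?g" "X \<in> k"
    using perspective_line_meets_side[of ?g' P' S' Z ?g P S D k] g g' D k persp sub \<pi> \<pi>' by blast
  obtain Y where Y: "Y \<in> ?h" "Y \<in> k"
    using perspective_line_meets_side[of ?h' Q' R' Z ?h Q R D k] h h' D k persp sub \<pi> \<pi>' by blast
  \<comment> \<open>Two different points of \<open>k\<close> in \<open>\<pi>\<close> would put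
    \<open>k\<close>, and with it \<open>Z\<close>, into \<open>\<pi>\<close>.\<close>
  have "X = Y"
    using line_subset_plane[of \<pi> X Y k] X Y k sub \<pi> by blast
  then have "meet ?g ?h = X"
    using meet_eq g h X Y \<open>?g \<noteq> ?h\<close> by blast
  then show ?thesis
    unfolding meet' collinear_def using k X by blast
qed

end

section \<open>From one diagonal point to the diagonal triangle\<close>

lemma collinear_rotate: "collinear L X Y W \<longleftrightarrow> collinear L Y W X"
  unfolding collinear_def by blast

lemma collinear_swap: "collinear L X Y W \<longleftrightarrow> collinear L Y X W"
  unfolding collinear_def by blast

text \<open>The inequalities and triples are oriented to match the cyclic permutations of
  \<open>P\<close>, \<open>Q\<close>, \<open>R\<close> that fix \<open>S\<close>.\<close>

lemma quadrangleD:
  assumes "quadrangle L \<pi> P Q R S"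
  shows "P \<in> \<pi>" "Q \<in> \<pi>" "R \<in> \<pi>" "S \<in> \<pi>"
    and "S \<noteq> P" "S \<noteq> Q" "S \<noteq> R" "Q \<noteq> R" "R \<noteq> P" "P \<noteq> Q"
    and "\<not> collinear L S P Q" "\<not> collinear L S Q R" "\<not> collinear L S R P"
  using assms collinear_rotate[of L S] collinear_swap[of L R P S]
  unfolding quadrangle_def by auto

theorem theorem1:
  fixes L :: "'p set set" and \<pi> \<pi>' :: "'p set"
    and Z P Q R S A B C P' Q' R' S' A' B' C' :: 'p
  assumes "projective_3_space L"
    and "plane L \<pi>'" and "plane L \<pi>" and "\<pi>' \<noteq> \<pi>"
    and "Z \<notin> \<pi>'" and "Z \<notin> \<pi>"
    and "quadrangle L \<pi>' P' Q' R' S'" and "quadrangle L \<pi> P Q R S"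
    and "diagonal_triangle L P' Q' R' S' = (A', B', C')"
    and "diagonal_triangle L P Q R S = (A, B, C)"
    and "perspective L Z [P', Q', R', S'] [P, Q, R, S]"
  shows "perspective L Z [A', B', C'] [A, B, C]"
proof -
  interpret projective_3_space L
    by fact
  have persp: "collinear L Z P' P" "collinear L Z Q' Q" "collinear L Z R' R" "collinear L Z S' S"
    using assms unfolding perspective_def by auto
  note quad = quadrangleD[OF \<open>quadrangle L \<pi> P Q R S\<close>]
    and quad' = quadrangleD[OF \<open>quadrangle L \<pi>' P' Q' R' S'\<close>]
  note diagonal = perspective_diagonal_point[OF \<open>plane L \<pi>\<close> \<open>Z \<notin> \<pi>\<close> _ _ _ _ _ _ _
      \<open>plane L \<pi>'\<close> \<open>Z \<notin> \<pi>'\<close>]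
  \<comment> \<open>Cycling \<open>P\<close>, \<open>Q\<close>, \<open>R\<close> with
    \<open>S\<close> fixed carries the pair of opposite sides defining \<open>A\<close> to those
    defining \<open>B\<close> and \<open>C\<close>.\<close>
  have "collinear L Z A' A" "collinear L Z B' B" "collinear L Z C' C"
    using diagonal[of P Q R S P' Q' R' S'] diagonal[of Q R P S Q' R' P' S']
      diagonal[of R P Q S R' P' Q' S'] persp quad quad' assms(9,10)
    unfolding diagonal_triangle_def by auto
  then show ?thesis
    unfolding perspective_def by simp
qed

end
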